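(* Let $\Sigma$ be a surface embedded in $M$. Defining $\mathcal J_M(X)=\gamma^{-1}\mathcal P(X)$ for all $X\in TM$ (at points of $\Sigma$), it holds that $\mathcal J_M(Y)=\mathcal J(Y)$ for all $Y\in T\Sigma$. That is, $\gamma^{-1}\mathcal P$ defines a complex structure on $T\Sigma$.
   Context: $\Sigma$ is a $2$-dimensional manifold embedded in a Riemannian manifold $(M,\bar g)$ with local coordinates $x^1,\dots,x^m$; $u^1,u^2$ are local coordinates on $\Sigma$ and the $x^i$ are regarded as functions of $u^1,u^2$. Repeated indices are summed. $\partial_a=\partial/\partial u^a$, $e_a=(\partial_ax^i)\partial_i$, $g_{ab}=\bar g(e_a,e_b)$, $g=\det(g_{ab})$; $\varepsilon^{ab}$ is the Levi-Civita symbol with $\varepsilon^{12}=1$. $\rho$ is an arbitrary non-vanishing density on $\Sigma$, $\gamma=\sqrt g/\rho$, and $\{f,h\}=\frac1\rho\varepsilon^{ab}(\partial_af)(\partial_bh)$. $\mathcal P^{ij}=\{x^i,x^j\}$, and $\mathcal P$ acts as a map $TM\to TM$ by $\mathcal P(X)^i=\mathcal P^{ij}\bar g_{jk}X^k$. $\mathcal J$ is the complex structure on $\Sigma$ associated with the induced metric, $\mathcal J(X)=\frac1{\sqrt g}\varepsilon^{ac}g_{cb}X^be_a$ for $X=X^be_b\in T\Sigma$. *)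

theory Defs
  imports "HOL-Analysis.Analysis"
begin

section \<open>Smooth maps between Euclidean spaces\<close>

text \<open>The following are meant for open \<open>S\<close>.\<close>

primrec Ck_on :: "nat \<Rightarrow> 'a::euclidean_space set \<Rightarrow> ('a \<Rightarrow> 'b::real_normed_vector) \<Rightarrow> bool" where
  "Ck_on 0 S f \<longleftrightarrow> continuous_on S f"
| "Ck_on (Suc k) S f \<longleftrightarrow> (\<forall>x\<in>S. f differentiable (at x)) \<and>
      (\<forall>v. Ck_on k S (\<lambda>x. frechet_derivative f (at x) v))"

definition smooth_on :: "'a::euclidean_space set \<Rightarrow> ('a \<Rightarrow> 'b::real_normed_vector) \<Rightarrow> bool" where
  "smooth_on S f \<longleftrightarrow> (\<forall>k. Ck_on k S f)"

section \<open>Manifolds, Riemannian metrics, embedded surfaces\<close>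

text \<open>A chart (local coordinate system) is a pair of a domain and a coordinate map. The values of
  the coordinate map outside the domain are irrelevant.\<close>

type_synonym ('p, 'n) chart = "'p set \<times> ('p \<Rightarrow> real ^ 'n)"

abbreviation dom_of :: "('p, 'n::finite) chart \<Rightarrow> 'p set" where
  "dom_of c \<equiv> fst c"

abbreviation coord :: "('p, 'n::finite) chart \<Rightarrow> 'p \<Rightarrow> real ^ 'n" where
  "coord c \<equiv> snd c"

definition param :: "('p, 'n::finite) chart \<Rightarrow> real ^ 'n \<Rightarrow> 'p" where
  "param c = inv_into (dom_of c) (coord c)"

definition chart_of :: "'p::topological_space set \<Rightarrow> ('p, 'n::finite) chart \<Rightarrow> bool" where
  "chart_of S c \<longleftrightarrow> openin (top_of_set S) (dom_of c) \<and> open (coord c ` dom_of c) \<and>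
     homeomorphism (dom_of c) (coord c ` dom_of c) (coord c) (param c)"

definition smooth_atlas :: "'p::topological_space set \<Rightarrow> ('p, 'n::finite) chart set \<Rightarrow> bool" where
  "smooth_atlas S \<A> \<longleftrightarrow> (\<forall>c\<in>\<A>. chart_of S c) \<and> (\<Union>c\<in>\<A>. dom_of c) = S \<and>
     (\<forall>c\<in>\<A>. \<forall>d\<in>\<A>. smooth_on (coord c ` (dom_of c \<inter> dom_of d)) (coord d \<circ> param c))"

text \<open>The differential at \<open>p\<close> of the change of coordinates from \<open>c\<close> to \<open>d\<close>. If \<open>c\<close> is a chart of
  a submanifold and \<open>d\<close> one of the ambient manifold, it is the differential of the inclusion.\<close>

definition coord_deriv ::
  "('p, 'n::finite) chart \<Rightarrow> ('p, 'k::finite) chart \<Rightarrow> 'p \<Rightarrow> real ^ 'n \<Rightarrow> real ^ 'k" where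
  "coord_deriv c d p = frechet_derivative (coord d \<circ> param c) (at (coord c p))"

text \<open>A tangent vector of \<open>M\<close> at \<open>p\<close> is represented by its components \<open>X :: real ^ 'm\<close> in a chart \<open>c\<close>;
  passing to a chart \<open>d\<close> it becomes \<open>coord_deriv c d p X\<close>. A metric is given by its component
  matrix \<open>G c p\<close> in each chart \<open>c\<close>.\<close>

definition metric_prod ::
  "(('p, 'm::finite) chart \<Rightarrow> 'p \<Rightarrow> real ^ 'm ^ 'm) \<Rightarrow> ('p, 'm) chart \<Rightarrow> 'p \<Rightarrow> real ^ 'm \<Rightarrow> real ^ 'm \<Rightarrow> real"
  where
  "metric_prod G c p X Y = (\<Sum>i\<in>UNIV. \<Sum>j\<in>UNIV. G c p $ i $ j * X $ i * Y $ j)"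

definition riemannian_metric ::
  "('p, 'm::finite) chart set \<Rightarrow> (('p, 'm) chart \<Rightarrow> 'p \<Rightarrow> real ^ 'm ^ 'm) \<Rightarrow> bool" where
  "riemannian_metric \<A> G \<longleftrightarrow>
     (\<forall>c\<in>\<A>. smooth_on (coord c ` dom_of c) (\<lambda>x. G c (param c x))) \<and>
     (\<forall>c\<in>\<A>. \<forall>p\<in>dom_of c. \<forall>i j. G c p $ i $ j = G c p $ j $ i) \<and>
     (\<forall>c\<in>\<A>. \<forall>p\<in>dom_of c. \<forall>X. X \<noteq> 0 \<longrightarrow> metric_prod G c p X X > 0) \<and>
     (\<forall>c\<in>\<A>. \<forall>d\<in>\<A>. \<forall>p\<in>dom_of c \<inter> dom_of d. \<forall>X Y.
        metric_prod G d p (coord_deriv c d p X) (coord_deriv c d p Y) = metric_prod G c p X Y)"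

text \<open>\<open>\<Sigma>\<close> carries the subspace topology and the inclusion into \<open>M\<close> is a smooth immersion.\<close>

definition embedded_surface ::
  "'p::topological_space set \<Rightarrow> ('p, 'm::finite) chart set \<Rightarrow> 'p set \<Rightarrow> ('p, 2) chart set \<Rightarrow> bool" where
  "embedded_surface M \<A> \<Sigma> \<B> \<longleftrightarrow> \<Sigma> \<subseteq> M \<and> smooth_atlas \<Sigma> \<B> \<and>
     (\<forall>c\<in>\<A>. \<forall>b\<in>\<B>. smooth_on (coord b ` (dom_of b \<inter> dom_of c)) (coord c \<circ> param b) \<and>
        (\<forall>p\<in>dom_of b \<inter> dom_of c. inj (coord_deriv b c p)))"

text \<open>A smooth non-vanishing density, given by its coefficient \<open>\<rho> b\<close> in each chart \<open>b\<close>.\<close>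

definition nonvanishing_density ::
  "('p, 2) chart set \<Rightarrow> (('p, 2) chart \<Rightarrow> 'p \<Rightarrow> real) \<Rightarrow> bool" where
  "nonvanishing_density \<B> \<rho> \<longleftrightarrow>
     (\<forall>b\<in>\<B>. smooth_on (coord b ` dom_of b) (\<lambda>u. \<rho> b (param b u))) \<and>
     (\<forall>b\<in>\<B>. \<forall>p\<in>dom_of b. \<rho> b p \<noteq> 0) \<and>
     (\<forall>b\<in>\<B>. \<forall>b'\<in>\<B>. \<forall>p\<in>dom_of b \<inter> dom_of b'.
        \<rho> b p = \<bar>det (matrix (coord_deriv b b' p))\<bar> * \<rho> b' p)"

text \<open>The charts in \<open>\<B>\<close> all induce the same orientation.\<close>

definition coherently_oriented :: "('p, 2) chart set \<Rightarrow> bool" where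
  "coherently_oriented \<B> \<longleftrightarrow>
     (\<forall>b\<in>\<B>. \<forall>b'\<in>\<B>. \<forall>p\<in>dom_of b \<inter> dom_of b'. det (matrix (coord_deriv b b' p)) > 0)"

section \<open>The Poisson bracket and the complex structure in local coordinates\<close>

text \<open>Throughout, \<open>c\<close> is a chart of \<open>M\<close> with coordinates \<open>x\<^sup>i\<close> and \<open>b\<close> is a chart of \<open>\<Sigma>\<close> with
  coordinates \<open>u\<^sup>1, u\<^sup>2\<close>. All quantities are evaluated at a point \<open>p\<close> of \<open>\<Sigma>\<close> in both domains.
  In the index type \<open>2\<close> the two indices are \<open>1\<close> and \<open>2\<close> (with \<open>2 = 0\<close>).\<close>

definition levi_civita :: "2 \<Rightarrow> 2 \<Rightarrow> real" where
  "levi_civita a b = (if a = 1 \<and> b = 2 then 1 else if a = 2 \<and> b = 1 then -1 else 0)"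

definition pd :: "('p, 2) chart \<Rightarrow> 2 \<Rightarrow> ('p \<Rightarrow> real) \<Rightarrow> 'p \<Rightarrow> real" where
  "pd b a f p = frechet_derivative (f \<circ> param b) (at (coord b p)) (axis a 1)"

definition poisson ::
  "(('p, 2) chart \<Rightarrow> 'p \<Rightarrow> real) \<Rightarrow> ('p, 2) chart \<Rightarrow> ('p \<Rightarrow> real) \<Rightarrow> ('p \<Rightarrow> real) \<Rightarrow> 'p \<Rightarrow> real" where
  "poisson \<rho> b f h p =
     1 / \<rho> b p * (\<Sum>a\<in>UNIV. \<Sum>a'\<in>UNIV. levi_civita a a' * pd b a f p * pd b a' h p)"

definition frame :: "('p, 'm::finite) chart \<Rightarrow> ('p, 2) chart \<Rightarrow> 'p \<Rightarrow> 2 \<Rightarrow> real ^ 'm" where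
  "frame c b p a = (\<chi> i. pd b a (\<lambda>q. coord c q $ i) p)"

definition tangent_space :: "('p, 'm::finite) chart \<Rightarrow> ('p, 2) chart \<Rightarrow> 'p \<Rightarrow> (real ^ 'm) set" where
  "tangent_space c b p = span (range (frame c b p))"

definition induced_metric ::
  "(('p, 'm::finite) chart \<Rightarrow> 'p \<Rightarrow> real ^ 'm ^ 'm) \<Rightarrow> ('p, 'm) chart \<Rightarrow> ('p, 2) chart \<Rightarrow> 'p \<Rightarrow> real ^ 2 ^ 2"
  where
  "induced_metric G c b p = (\<chi> a a'. metric_prod G c p (frame c b p a) (frame c b p a'))"

definition gamma ::
  "(('p, 'm::finite) chart \<Rightarrow> 'p \<Rightarrow> real ^ 'm ^ 'm) \<Rightarrow> (('p, 2) chart \<Rightarrow> 'p \<Rightarrow> real) \<Rightarrow>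
   ('p, 'm) chart \<Rightarrow> ('p, 2) chart \<Rightarrow> 'p \<Rightarrow> real" where
  "gamma G \<rho> c b p = sqrt (det (induced_metric G c b p)) / \<rho> b p"

definition P_tensor ::
  "(('p, 2) chart \<Rightarrow> 'p \<Rightarrow> real) \<Rightarrow> ('p, 'm::finite) chart \<Rightarrow> ('p, 2) chart \<Rightarrow> 'p \<Rightarrow> real ^ 'm ^ 'm" where
  "P_tensor \<rho> c b p = (\<chi> i j. poisson \<rho> b (\<lambda>q. coord c q $ i) (\<lambda>q. coord c q $ j) p)"

definition P_map ::
  "(('p, 'm::finite) chart \<Rightarrow> 'p \<Rightarrow> real ^ 'm ^ 'm) \<Rightarrow> (('p, 2) chart \<Rightarrow> 'p \<Rightarrow> real) \<Rightarrow>
   ('p, 'm) chart \<Rightarrow> ('p, 2) chart \<Rightarrow> 'p \<Rightarrow> real ^ 'm \<Rightarrow> real ^ 'm" where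
  "P_map G \<rho> c b p X =
     (\<chi> i. \<Sum>j\<in>UNIV. \<Sum>k\<in>UNIV. P_tensor \<rho> c b p $ i $ j * G c p $ j $ k * X $ k)"

definition J_M ::
  "(('p, 'm::finite) chart \<Rightarrow> 'p \<Rightarrow> real ^ 'm ^ 'm) \<Rightarrow> (('p, 2) chart \<Rightarrow> 'p \<Rightarrow> real) \<Rightarrow>
   ('p, 'm) chart \<Rightarrow> ('p, 2) chart \<Rightarrow> 'p \<Rightarrow> real ^ 'm \<Rightarrow> real ^ 'm" where
  "J_M G \<rho> c b p X = inverse (gamma G \<rho> c b p) *\<^sub>R P_map G \<rho> c b p X"

text \<open>The components \<open>Y\<^sup>a\<close> of a tangent vector \<open>Y = Y\<^sup>a e\<^sub>a\<close> of \<open>\<Sigma>\<close>, unique on an embedded surface.\<close>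

definition tangent_components ::
  "('p, 'm::finite) chart \<Rightarrow> ('p, 2) chart \<Rightarrow> 'p \<Rightarrow> real ^ 'm \<Rightarrow> real ^ 2" where
  "tangent_components c b p Y = (THE X. Y = (\<Sum>a\<in>UNIV. X $ a *\<^sub>R frame c b p a))"

definition J_Sigma ::
  "(('p, 'm::finite) chart \<Rightarrow> 'p \<Rightarrow> real ^ 'm ^ 'm) \<Rightarrow>
   ('p, 'm) chart \<Rightarrow> ('p, 2) chart \<Rightarrow> 'p \<Rightarrow> real ^ 'm \<Rightarrow> real ^ 'm" where
  "J_Sigma G c b p Y =
     (1 / sqrt (det (induced_metric G c b p))) *\<^sub>R
       (\<Sum>a\<in>UNIV. \<Sum>d\<in>UNIV. \<Sum>a'\<in>UNIV.
          (levi_civita a d * induced_metric G c b p $ d $ a' * tangent_components c b p Y $ a')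
            *\<^sub>R frame c b p a)"

text \<open>A smooth bundle endomorphism of \<open>T\<Sigma>\<close> (over the union of the domains of the charts in \<open>\<B>\<close>)
  squaring to minus the identity. It is given in components, \<open>J c b p\<close> being its expression at \<open>p\<close> in
  the charts \<open>c\<close> and \<open>b\<close>; the last clause says that these expressions define one and the same map,
  independently of the charts. Smoothness of a linear \<open>J\<close> is smoothness of \<open>J(e\<^sub>a)\<close>
  for each \<open>a\<close>.\<close>

definition complex_structure_on_tangent_bundle ::
  "('p, 'm::finite) chart set \<Rightarrow> ('p, 2) chart set \<Rightarrow>
   (('p, 'm) chart \<Rightarrow> ('p, 2) chart \<Rightarrow> 'p \<Rightarrow> real ^ 'm \<Rightarrow> real ^ 'm) \<Rightarrow> bool" where
  "complex_structure_on_tangent_bundle \<A> \<B> J \<longleftrightarrow>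
     (\<forall>c\<in>\<A>. \<forall>b\<in>\<B>. \<forall>p\<in>dom_of c \<inter> dom_of b.
        (\<forall>Y\<in>tangent_space c b p. J c b p Y \<in> tangent_space c b p) \<and>
        (\<forall>Y\<in>tangent_space c b p. \<forall>Z\<in>tangent_space c b p. \<forall>s t.
           J c b p (s *\<^sub>R Y + t *\<^sub>R Z) = s *\<^sub>R J c b p Y + t *\<^sub>R J c b p Z) \<and>
        (\<forall>Y\<in>tangent_space c b p. J c b p (J c b p Y) = - Y)) \<and>
     (\<forall>c\<in>\<A>. \<forall>b\<in>\<B>. \<forall>a. smooth_on (coord b ` (dom_of c \<inter> dom_of b))
        (\<lambda>u. J c b (param b u) (frame c b (param b u) a))) \<and>
     (\<forall>c\<in>\<A>. \<forall>c'\<in>\<A>. \<forall>b\<in>\<B>. \<forall>b'\<in>\<B>. \<forall>p\<in>dom_of c \<inter> dom_of c' \<inter> dom_of b \<inter> dom_of b'.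
        \<forall>Y\<in>tangent_space c b p. coord_deriv c c' p (J c b p Y) = J c' b' p (coord_deriv c c' p Y))"

end

theory Submission
  imports Defs
begin

text \<open>Write \<open>B\<close> for the metric at a point and \<open>e, f\<close> for the frame \<open>e\<^sub>1, e\<^sub>2\<close>. The density cancels in
  \<open>\<gamma>\<^sup>-\<^sup>1 \<P>\<close>, which leaves \<open>X \<mapsto> (B(f, X) e - B(e, X) f) / \<surd>g\<close> with \<open>g\<close> the Gram determinant of \<open>e, f\<close>.
  On the plane spanned by \<open>e, f\<close> this is the rotation by a right angle: it squares to \<open>-1\<close>.
  The numerator is alternating in \<open>(e, f)\<close> and \<open>\<surd>g\<close> scales by the absolute value of the
  determinant of a base change, so the map depends only on the orientation of the frame;
  hence it is independent of the charts as soon as these are coherently oriented.\<close>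

section \<open>Calculus of smooth maps\<close>

text \<open>The base case is that differentiability implies continuity. The product and chain rules
  need this, since they put \<open>f\<close> itself next to its derivative, which is one order less
  regular.\<close>

lemma Ck_on_SucD: "Ck_on (Suc k) S f \<Longrightarrow> Ck_on k S f"
  by (induction k arbitrary: f)
    (auto intro!: continuous_at_imp_continuous_on differentiable_imp_continuous_within)

lemma frechet_derivative_transform_within_open:
  assumes "f differentiable (at x)" "open S" "x \<in> S" "\<And>y. y \<in> S \<Longrightarrow> f y = g y"
  shows "g differentiable (at x)" "frechet_derivative g (at x) = frechet_derivative f (at x)"
proof -
  have "(g has_derivative frechet_derivative f (at x)) (at x)"
    using assms frechet_derivative_works has_derivative_transform_within_open by blast
  then show "g differentiable (at x)" "frechet_derivative g (at x) = frechet_derivative f (at x)"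
    using differentiableI frechet_derivative_at by metis+
qed

text \<open>Derivatives at a point of an open set see only values in that set. Maps built from
  \<open>param\<close> are arbitrary off the chart image, so smoothness must not depend on values
  there.\<close>

lemma Ck_on_cong:
  assumes "Ck_on k S f" "open S" "\<And>x. x \<in> S \<Longrightarrow> f x = g x"
  shows "Ck_on k S g"
  using assms(1,3)
proof (induction k arbitrary: f g)
  case 0
  then show ?case
    by (metis Ck_on.simps(1) continuous_on_eq)
next
  case (Suc k)
  have diff: "f differentiable (at x)" if "x \<in> S" for x
    using Suc.prems that by simp
  have deriv: "g differentiable (at x)" "frechet_derivative f (at x) = frechet_derivative g (at x)"
    if "x \<in> S" for x
    using frechet_derivative_transform_within_open[OF diff[OF that] assms(2) that Suc.prems(2)]
    by simp_all
  have "Ck_on k S (\<lambda>x. frechet_derivative g (at x) v)" for v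
  proof (rule Suc.IH)
    show "Ck_on k S (\<lambda>x. frechet_derivative f (at x) v)"
      using Suc.prems(1) by simp
  qed (simp add: deriv(2))
  then show ?case
    using deriv(1) by simp
qed

text \<open>\<open>frechet_derivative\<close> is a choice operator; by uniqueness any explicit
  derivative \<open>f'\<close> may take its place, so the calculus rules can be used directly in the
  inductions below.\<close>

lemma Ck_on_SucI:
  assumes "open S" "\<And>x. x \<in> S \<Longrightarrow> (f has_derivative f' x) (at x)"
    "\<And>v. Ck_on k S (\<lambda>x. f' x v)"
  shows "Ck_on (Suc k) S f"
proof -
  have "Ck_on k S (\<lambda>x. frechet_derivative f (at x) v)" for v
    by (rule Ck_on_cong[OF assms(3)[of v] assms(1)]) (metis assms(2) frechet_derivative_at)
  then show ?thesis
    using assms(2) differentiableI by (metis Ck_on.simps(2))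
qed

lemma Ck_on_Suc_has_derivative:
  "Ck_on (Suc k) S f \<Longrightarrow> x \<in> S \<Longrightarrow> (f has_derivative frechet_derivative f (at x)) (at x)"
  using frechet_derivative_works by auto

lemma Ck_on_const: "open S \<Longrightarrow> Ck_on k S (\<lambda>x. c)"
proof (induction k arbitrary: c)
  case (Suc k)
  show ?case
    by (rule Ck_on_SucI[OF Suc.prems has_derivative_const]) (simp add: Suc)
qed simp

lemma Ck_on_linear:
  assumes "bounded_linear L"
  shows "open S \<Longrightarrow> Ck_on k S f \<Longrightarrow> Ck_on k S (\<lambda>x. L (f x))"
proof (induction k arbitrary: f)
  case 0
  then show ?case
    by (simp add: bounded_linear.continuous_on[OF assms])
next
  case (Suc k)
  show ?case
    by (rule Ck_on_SucI[OF Suc.prems(1) bounded_linear.has_derivative[OF assms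
          Ck_on_Suc_has_derivative[OF Suc.prems(2)]]])
      (use Suc.prems in \<open>simp_all add: Suc.IH\<close>)
qed

lemma Ck_on_add:
  "open S \<Longrightarrow> Ck_on k S f \<Longrightarrow> Ck_on k S g \<Longrightarrow> Ck_on k S (\<lambda>x. f x + g x)"
proof (induction k arbitrary: f g)
  case 0
  then show ?case
    by (simp add: continuous_on_add)
next
  case (Suc k)
  show ?case
    by (rule Ck_on_SucI[OF Suc.prems(1) has_derivative_add[OF
          Ck_on_Suc_has_derivative[OF Suc.prems(2)] Ck_on_Suc_has_derivative[OF Suc.prems(3)]]])
      (use Suc.prems in \<open>simp_all add: Suc.IH\<close>)
qed

lemma Ck_on_sum:
  assumes "open S" "finite I" "\<And>i. i \<in> I \<Longrightarrow> Ck_on k S (f i)"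
  shows "Ck_on k S (\<lambda>x. \<Sum>i\<in>I. f i x)"
  using assms(2,3) by (induction I rule: finite_induct) (auto intro: assms(1) Ck_on_const Ck_on_add)

text \<open>Both summands of the product rule are again \<open>op2\<close> of two maps of order
  \<open>k\<close>, so the induction closes once \<open>f\<close> and \<open>g\<close> are
  generalised. This covers products and scalings at once.\<close>

lemma Ck_on_bilinear:
  assumes "bounded_bilinear op2"
  shows "open S \<Longrightarrow> Ck_on k S f \<Longrightarrow> Ck_on k S g \<Longrightarrow> Ck_on k S (\<lambda>x. op2 (f x) (g x))"
proof (induction k arbitrary: f g)
  case 0
  then show ?case
    by (simp add: bounded_bilinear.continuous_on[OF assms])
next
  case (Suc k)
  have "Ck_on k S (\<lambda>x. op2 (f x) (frechet_derivative g (at x) v) +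
      op2 (frechet_derivative f (at x) v) (g x))" for v
    using Suc.prems Ck_on_SucD[OF Suc.prems(2)] Ck_on_SucD[OF Suc.prems(3)]
    by (intro Ck_on_add Suc.IH) simp_all
  then show ?case
    by (intro Ck_on_SucI[OF Suc.prems(1) bounded_bilinear.FDERIV[OF assms
          Ck_on_Suc_has_derivative[OF Suc.prems(2)] Ck_on_Suc_has_derivative[OF Suc.prems(3)]]])
qed

text \<open>Serves the chain rule: it trades a direction that moves with the point for fixed basis
  directions with moving coefficients.\<close>

lemma linear_sum_Basis:
  fixes L :: "'a::euclidean_space \<Rightarrow> 'b::real_vector"
  assumes "linear L"
  shows "L v = (\<Sum>i\<in>Basis. (v \<bullet> i) *\<^sub>R L i)"
proof -
  have "L v = L (\<Sum>i\<in>Basis. (v \<bullet> i) *\<^sub>R i)"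
    by (simp add: euclidean_representation)
  also have "\<dots> = (\<Sum>i\<in>Basis. (v \<bullet> i) *\<^sub>R L i)"
    by (simp add: linear_sum[OF assms] linear_cmul[OF assms])
  finally show ?thesis .
qed

lemma Ck_on_compose:
  fixes f :: "'a::euclidean_space \<Rightarrow> 'b::euclidean_space" and g :: "'b \<Rightarrow> 'c::real_normed_vector"
  assumes "open S" "f ` S \<subseteq> T"
  shows "Ck_on k S f \<Longrightarrow> Ck_on k T g \<Longrightarrow> Ck_on k S (\<lambda>x. g (f x))"
proof (induction k arbitrary: g)
  case 0
  then show ?case
    using assms continuous_on_compose2 by auto
next
  case (Suc k)
  have fx: "f x \<in> T" if "x \<in> S" for x
    using that assms by auto
  have deriv: "((\<lambda>x. g (f x)) has_derivative
      (\<lambda>v. frechet_derivative g (at (f x)) (frechet_derivative f (at x) v))) (at x)"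
    if "x \<in> S" for x
    using diff_chain_at[OF Ck_on_Suc_has_derivative[OF Suc.prems(1) that]
        Ck_on_Suc_has_derivative[OF Suc.prems(2) fx[OF that]]]
    by (simp add: o_def)
  \<comment> \<open>\<open>Ck_on\<close> controls the derivative of \<open>g\<close> only in fixed
    directions, while the direction here varies with \<open>x\<close>. Expanded in the basis, each
    summand is a coefficient times \<open>g'\<close> in a fixed direction composed with
    \<open>f\<close>, to which the induction hypothesis applies.\<close>
  have "Ck_on k S (\<lambda>x. frechet_derivative g (at (f x)) (frechet_derivative f (at x) v))" for v
  proof (rule Ck_on_cong[OF _ assms(1)])
    show "Ck_on k S (\<lambda>x. \<Sum>i\<in>Basis. (frechet_derivative f (at x) v \<bullet> i) *\<^sub>R
        frechet_derivative g (at (f x)) i)"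
      using Suc.prems
      by (intro Ck_on_sum Ck_on_bilinear[OF bounded_bilinear_scaleR]
          Ck_on_linear[OF bounded_linear_inner_left] Suc.IH assms Ck_on_SucD[OF Suc.prems(1)]) auto
    show "(\<Sum>i\<in>Basis. (frechet_derivative f (at x) v \<bullet> i) *\<^sub>R frechet_derivative g (at (f x)) i) =
        frechet_derivative g (at (f x)) (frechet_derivative f (at x) v)" if "x \<in> S" for x
      using Suc.prems(2) fx[OF that]
      by (intro linear_sum_Basis[symmetric] linear_frechet_derivative) simp
  qed
  then show ?case
    by (intro Ck_on_SucI[OF assms(1) deriv])
qed

text \<open>The factor \<open>c\<close> makes the family closed under differentiation: the
  derivative in direction \<open>v\<close> has constant \<open>v * c * r\<close> and exponent
  \<open>r - 1\<close>.\<close>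

lemma Ck_on_powr: "Ck_on k {0<..} (\<lambda>t::real. c * t powr r)"
proof (induction k arbitrary: c r)
  case 0
  then show ?case
    by (auto intro!: continuous_intros)
next
  case (Suc k)
  have "Ck_on k {0<..} (\<lambda>t::real. v * (c * r * t powr (r - 1)))" for v
    using Suc.IH[of "v * (c * r)" "r - 1"] by (simp add: mult.assoc)
  moreover have "((\<lambda>t. c * t powr r) has_derivative (\<lambda>v. v * (c * r * t powr (r - 1)))) (at t)"
    if "t \<in> {0<..}" for t :: real
    using that by (auto intro!: derivative_eq_intros simp: field_simps powr_diff)
  ultimately show ?case
    by (intro Ck_on_SucI[where f' = "\<lambda>t v. v * (c * r * t powr (r - 1))"]) auto
qed

section \<open>Closure properties of smooth maps\<close>

lemma smooth_on_cong:
  "smooth_on S f \<Longrightarrow> open S \<Longrightarrow> (\<And>x. x \<in> S \<Longrightarrow> f x = g x) \<Longrightarrow> smooth_on S g"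
  unfolding smooth_on_def by (metis Ck_on_cong)

lemma smooth_on_add: "open S \<Longrightarrow> smooth_on S f \<Longrightarrow> smooth_on S g \<Longrightarrow> smooth_on S (\<lambda>x. f x + g x)"
  unfolding smooth_on_def by (metis Ck_on_add)

lemma smooth_on_sum:
  "open S \<Longrightarrow> finite I \<Longrightarrow> (\<And>i. i \<in> I \<Longrightarrow> smooth_on S (f i)) \<Longrightarrow> smooth_on S (\<lambda>x. \<Sum>i\<in>I. f i x)"
  unfolding smooth_on_def by (metis Ck_on_sum)

lemma smooth_on_linear:
  "bounded_linear L \<Longrightarrow> open S \<Longrightarrow> smooth_on S f \<Longrightarrow> smooth_on S (\<lambda>x. L (f x))"
  unfolding smooth_on_def by (metis Ck_on_linear)

lemma smooth_on_bilinear: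
  "bounded_bilinear op2 \<Longrightarrow> open S \<Longrightarrow> smooth_on S f \<Longrightarrow> smooth_on S g \<Longrightarrow>
    smooth_on S (\<lambda>x. op2 (f x) (g x))"
  unfolding smooth_on_def by (metis Ck_on_bilinear)

lemmas smooth_on_mult = smooth_on_bilinear[OF bounded_bilinear_mult]
lemmas smooth_on_scaleR = smooth_on_bilinear[OF bounded_bilinear_scaleR]
lemmas smooth_on_vec_nth = smooth_on_linear[OF bounded_linear_vec_nth]

lemma smooth_on_minus: "open S \<Longrightarrow> smooth_on S f \<Longrightarrow> smooth_on S (\<lambda>x. - f x)"
  by (rule smooth_on_linear[OF bounded_linear_minus[OF bounded_linear_ident]])

lemma smooth_on_diff: "open S \<Longrightarrow> smooth_on S f \<Longrightarrow> smooth_on S g \<Longrightarrow> smooth_on S (\<lambda>x. f x - g x)"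
  using smooth_on_add[OF _ _ smooth_on_minus, of S f g] by simp

lemma smooth_on_compose:
  fixes f :: "'a::euclidean_space \<Rightarrow> 'b::euclidean_space"
  shows "open S \<Longrightarrow> f ` S \<subseteq> T \<Longrightarrow> smooth_on S f \<Longrightarrow> smooth_on T g \<Longrightarrow> smooth_on S (\<lambda>x. g (f x))"
  unfolding smooth_on_def by (metis Ck_on_compose)

lemma smooth_on_inverse_sqrt:
  assumes "open S" "smooth_on S f" "\<And>x. x \<in> S \<Longrightarrow> 0 < f x"
  shows "smooth_on S (\<lambda>x. 1 / sqrt (f x))"
proof (rule smooth_on_cong)
  \<comment> \<open>The inverse square root is the power with exponent -1/2; the factor 1 matches
    the shape in \<open>Ck_on_powr\<close>.\<close>
  have "smooth_on {0<..} (\<lambda>t::real. 1 * t powr - (1/2))"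
    unfolding smooth_on_def using Ck_on_powr by blast
  then show "smooth_on S (\<lambda>x. 1 * f x powr - (1/2))"
    by (rule smooth_on_compose[OF assms(1) _ assms(2), rotated]) (use assms(3) in auto)
  show "1 * f x powr - (1/2) = 1 / sqrt (f x)" if "x \<in> S" for x
    using assms(3)[OF that] by (simp add: powr_minus_divide powr_half_sqrt)
qed (rule assms(1))

lemma smooth_on_imp_differentiable: "smooth_on S f \<Longrightarrow> x \<in> S \<Longrightarrow> f differentiable (at x)"
  unfolding smooth_on_def by (metis Ck_on.simps(2))

lemma smooth_on_frechet_derivative:
  "smooth_on S f \<Longrightarrow> smooth_on S (\<lambda>x. frechet_derivative f (at x) v)"
  unfolding smooth_on_def by (metis Ck_on.simps(2))

section \<open>The rotation by a right angle in a plane\<close>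

text \<open>For orthonormal \<open>e\<close>, \<open>f\<close> this sends \<open>e\<close> to
  \<open>- f\<close> and \<open>f\<close> to \<open>e\<close>, and it vanishes on vectors orthogonal
  to both. The denominator is the area of the parallelogram spanned by \<open>e\<close> and
  \<open>f\<close>.\<close>

definition quarter_turn :: "('v::real_vector \<Rightarrow> 'v \<Rightarrow> real) \<Rightarrow> 'v \<Rightarrow> 'v \<Rightarrow> 'v \<Rightarrow> 'v" where
  "quarter_turn B e f X =
     (1 / sqrt (B e e * B f f - B e f * B f e)) *\<^sub>R (B f X *\<^sub>R e - B e X *\<^sub>R f)"

lemma span_pairE:
  assumes "Y \<in> span {e, f}"
  obtains s t where "Y = s *\<^sub>R e + t *\<^sub>R f"
proof -
  obtain s where "Y - s *\<^sub>R e \<in> span {f}"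
    using assms span_breakdown_eq by blast
  then obtain t where "Y - s *\<^sub>R e = t *\<^sub>R f"
    by (auto simp: span_singleton)
  then show ?thesis
    using that[of s t] by (metis add.commute diff_add_cancel)
qed

locale pos_def_form =
  fixes B :: "'v::real_vector \<Rightarrow> 'v \<Rightarrow> real"
  assumes bilinear: "bilinear B"
    and sym: "B X Y = B Y X"
    and pos: "X \<noteq> 0 \<Longrightarrow> 0 < B X X"
begin

lemmas simps = bilinear_ladd[OF bilinear] bilinear_radd[OF bilinear] bilinear_lmul[OF bilinear]
  bilinear_rmul[OF bilinear] bilinear_lsub[OF bilinear] bilinear_rsub[OF bilinear]

text \<open>Strict Cauchy-Schwarz. Independence is phrased with coefficients because the set
  \<open>{e, f}\<close> would also be independent for \<open>e = f\<close> nonzero.\<close>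

lemma gram_det_pos:
  assumes indep: "\<And>s t. s *\<^sub>R e + t *\<^sub>R f = 0 \<Longrightarrow> s = 0 \<and> t = 0"
  shows "0 < B e e * B f f - B e f * B f e"
proof -
  have "e \<noteq> 0"
    using indep[of 1 0] by auto
  then have ee: "0 < B e e"
    by (rule pos)
  \<comment> \<open>\<open>B e e\<close> times the part of \<open>f\<close> orthogonal to
    \<open>e\<close>; its square length is \<open>B e e\<close> times the Gram determinant.\<close>
  define X where "X = (- B e f) *\<^sub>R e + B e e *\<^sub>R f"
  have "X \<noteq> 0"
    unfolding X_def using indep ee by fastforce
  then have "0 < B X X"
    by (rule pos)
  also have "B X X = B e e * (B e e * B f f - B e f * B f e)"
    unfolding X_def by (simp add: simps sym[of f e] algebra_simps)
  finally show ?thesis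
    using ee zero_less_mult_pos by blast
qed

lemma quarter_turn_lincomb:
  "quarter_turn B e f (s *\<^sub>R Y + t *\<^sub>R Z) = s *\<^sub>R quarter_turn B e f Y + t *\<^sub>R quarter_turn B e f Z"
  unfolding quarter_turn_def by (simp add: simps algebra_simps)

lemma quarter_turn_in_span: "quarter_turn B e f X \<in> span {e, f}"
  unfolding quarter_turn_def by (intro span_mul span_diff) (auto intro: span_base)

lemma quarter_turn_square:
  assumes "0 < B e e * B f f - B e f * B f e" and Y: "Y \<in> span {e, f}"
  shows "quarter_turn B e f (quarter_turn B e f Y) = - Y"
proof -
  define w where "w = 1 / sqrt (B e e * B f f - B e f * B f e)"
  have w: "w * w * (B e e * B f f - B e f * B f e) = 1"
    unfolding w_def using assms(1) by simp
  have turn: "quarter_turn B e f X = w *\<^sub>R (B f X *\<^sub>R e - B e X *\<^sub>R f)" for X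
    by (simp add: quarter_turn_def w_def)
  \<comment> \<open>By linearity the frame vectors suffice. On each of them the mixed terms cancel
    and the Gram determinant appears, which \<open>w * w\<close> normalises to 1.\<close>
  have "quarter_turn B e f (quarter_turn B e f e) = (- (w * w * (B e e * B f f - B e f * B f e))) *\<^sub>R e"
    "quarter_turn B e f (quarter_turn B e f f) = (- (w * w * (B e e * B f f - B e f * B f e))) *\<^sub>R f"
    unfolding turn by (simp_all add: simps sym[of f e] algebra_simps)
  then have ef: "quarter_turn B e f (quarter_turn B e f e) = - e"
    "quarter_turn B e f (quarter_turn B e f f) = - f"
    unfolding w by simp_all
  obtain s t where "Y = s *\<^sub>R e + t *\<^sub>R f"
    using Y by (rule span_pairE)
  then show ?thesis
    by (simp add: quarter_turn_lincomb ef)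
qed

lemma quarter_turn_basis_change:
  assumes e: "e = p *\<^sub>R e' + q *\<^sub>R f'" and f: "f = r *\<^sub>R e' + s *\<^sub>R f'"
    and orient: "0 < p * s - q * r"
  shows "quarter_turn B e f X = quarter_turn B e' f' X"
proof -
  define D where "D = p * s - q * r"
  define g where "g = B e' e' * B f' f' - B e' f' * B f' e'"
  have gram: "B e e * B f f - B e f * B f e = D\<^sup>2 * g"
    unfolding e f D_def g_def
    by (simp add: simps sym[of f' e'] algebra_simps power2_eq_square)
  have num: "B f X *\<^sub>R e - B e X *\<^sub>R f = D *\<^sub>R (B f' X *\<^sub>R e' - B e' X *\<^sub>R f')"
    unfolding e f D_def by (simp add: simps algebra_simps)
  \<comment> \<open>The root of the Gram determinant yields \<open>\<bar>D\<bar>\<close>, the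
    numerator yields \<open>D\<close>; they cancel because the orientation is kept.\<close>
  have "D > 0"
    using orient by (simp add: D_def)
  then show ?thesis
    unfolding quarter_turn_def gram num g_def[symmetric] by (simp add: real_sqrt_mult)
qed

end

section \<open>The metric at a point as a positive definite form\<close>

lemma pos_def_form_metric_prod:
  assumes "riemannian_metric \<A> G" "c \<in> \<A>" "p \<in> dom_of c"
  shows "pos_def_form (metric_prod G c p)"
proof
  have "bilinear (\<lambda>X Y. \<Sum>i\<in>UNIV. \<Sum>j\<in>UNIV. G c p $ i $ j * X $ i * Y $ j)"
    unfolding bilinear_def
    by (auto intro!: linearI simp: algebra_simps sum.distrib sum_distrib_left)
  then show "bilinear (metric_prod G c p)"
    by (simp add: metric_prod_def[abs_def])
  have G: "G c p $ i $ j = G c p $ j $ i" for i j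
    using assms unfolding riemannian_metric_def by blast
  show "metric_prod G c p X Y = metric_prod G c p Y X" for X Y
    unfolding metric_prod_def by (subst sum.swap) (simp add: G mult_ac)
  show "0 < metric_prod G c p X X" if "X \<noteq> 0" for X
    using assms that unfolding riemannian_metric_def by blast
qed

section \<open>Coordinate changes\<close>

lemma param_coord: "chart_of S c \<Longrightarrow> p \<in> dom_of c \<Longrightarrow> param c (coord c p) = p"
  unfolding chart_of_def using homeomorphism_apply1 by blast

text \<open>A chart is a homeomorphism onto an open set, so relatively open sets have truly open
  images. The smoothness lemmas need such open domains.\<close>

lemma open_coord_image:
  assumes "chart_of S b" "openin (top_of_set S) U"
  shows "open (coord b ` (dom_of b \<inter> U))"
proof -
  have hom: "homeomorphism (dom_of b) (coord b ` dom_of b) (coord b) (param b)"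
    and "open (coord b ` dom_of b)" and dom: "openin (top_of_set S) (dom_of b)"
    using assms by (auto simp: chart_of_def)
  have "openin (top_of_set (dom_of b)) (dom_of b \<inter> U)"
    by (rule openin_subset_trans[of S])
      (use dom assms(2) openin_imp_subset in auto)
  then show ?thesis
    using homeomorphism_imp_open_map[OF hom] \<open>open (coord b ` dom_of b)\<close> openin_open_trans by blast
qed

text \<open>The maps \<open>coord d \<circ> param b\<close> and
  \<open>(coord d \<circ> param c) \<circ> (coord c \<circ> param b)\<close> agree only on the
  overlap of \<open>b\<close> and \<open>c\<close>, whose open image makes this enough. The carriers
  \<open>S\<close> and \<open>S'\<close> are separate so that \<open>b\<close> may be a chart of the
  surface and \<open>c\<close> one of the ambient manifold.\<close>

lemma coord_deriv_chain:
  assumes c: "chart_of S' c" and b: "chart_of S b"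
    and "open (coord b ` (dom_of b \<inter> dom_of c))" "p \<in> dom_of b" "p \<in> dom_of c"
    and cb: "(coord c \<circ> param b) differentiable (at (coord b p))"
    and dc: "(coord d \<circ> param c) differentiable (at (coord c p))"
  shows "coord_deriv b d p v = coord_deriv c d p (coord_deriv b c p v)"
proof -
  have "(coord c \<circ> param b) (coord b p) = coord c p"
    using param_coord[OF b] assms by simp
  then have chain: "((coord d \<circ> param c) \<circ> (coord c \<circ> param b) has_derivative
      coord_deriv c d p \<circ> coord_deriv b c p) (at (coord b p))"
    unfolding coord_deriv_def using cb dc frechet_derivative_works
    by (metis diff_chain_at)
  have "(coord d \<circ> param b has_derivative coord_deriv c d p \<circ> coord_deriv b c p) (at (coord b p))"
  proof (rule has_derivative_transform_within_open[OF chain assms(3)])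
    show "coord b p \<in> coord b ` (dom_of b \<inter> dom_of c)"
      using assms by blast
    show "(coord d \<circ> param c \<circ> (coord c \<circ> param b)) u = (coord d \<circ> param b) u"
      if "u \<in> coord b ` (dom_of b \<inter> dom_of c)" for u
      using that param_coord[OF b] param_coord[OF c] by auto
  qed
  then show ?thesis
    unfolding coord_deriv_def[of b d] by (metis frechet_derivative_at comp_apply)
qed

text \<open>\<open>frame\<close> differentiates one coordinate function at a time; for a
  differentiable vector map the components of the derivative are the derivatives of the
  components.\<close>

lemma frame_eq_coord_deriv:
  assumes "(coord c \<circ> param b) differentiable (at (coord b p))"
  shows "frame c b p a = coord_deriv b c p (axis a 1)"
proof -
  have "((\<lambda>q. coord c q $ i) \<circ> param b has_derivative (\<lambda>v. coord_deriv b c p v $ i)) (at (coord b p))"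
    for i
    using bounded_linear.has_derivative[OF bounded_linear_vec_nth assms[unfolded frechet_derivative_works]]
    by (simp add: coord_deriv_def o_def)
  then have "pd b a (\<lambda>q. coord c q $ i) p = coord_deriv b c p (axis a 1) $ i" for i
    unfolding pd_def by (metis frechet_derivative_at)
  then show ?thesis
    by (simp add: frame_def vec_eq_iff)
qed

section \<open>Coordinate expressions in terms of the frame\<close>

lemma tangent_space_eq: "tangent_space c b p = span {frame c b p 1, frame c b p 2}"
  by (simp add: tangent_space_def UNIV_2)

lemma det_induced_metric:
  "det (induced_metric G c b p) =
     metric_prod G c p (frame c b p 1) (frame c b p 1) * metric_prod G c p (frame c b p 2) (frame c b p 2) -
     metric_prod G c p (frame c b p 1) (frame c b p 2) * metric_prod G c p (frame c b p 2) (frame c b p 1)"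
  by (simp add: induced_metric_def det_2)

lemma levi_civita_simps [simp]:
  "levi_civita 1 1 = 0" "levi_civita 1 2 = 1" "levi_civita 2 1 = - 1" "levi_civita 2 2 = 0"
  by (simp_all add: levi_civita_def)

text \<open>The bracket of the coordinate functions is the bivector
  \<open>e\<^sub>1 \<and> e\<^sub>2\<close> divided by \<rho>; contracting its second slot with
  \<open>X\<close> through the metric gives the formula.\<close>

lemma P_map_eq:
  "P_map G \<rho> c b p X = (1 / \<rho> b p) *\<^sub>R
     (metric_prod G c p (frame c b p 2) X *\<^sub>R frame c b p 1 -
      metric_prod G c p (frame c b p 1) X *\<^sub>R frame c b p 2)"
proof -
  have P: "P_tensor \<rho> c b p $ i $ j =
      1 / \<rho> b p * (frame c b p 1 $ i * frame c b p 2 $ j - frame c b p 2 $ i * frame c b p 1 $ j)" for i j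
    by (simp add: P_tensor_def poisson_def frame_def sum_2)
  show ?thesis
    unfolding vec_eq_iff P_map_def metric_prod_def P
    by (simp add: sum_distrib_left sum_distrib_right sum_subtractf algebra_simps)
qed

text \<open>Valid for every ambient vector \<open>X\<close>. Where the Gram determinant is 0, both
  sides are 0 because division by 0 yields 0.\<close>

lemma J_M_eq:
  assumes "\<rho> b p \<noteq> 0"
  shows "J_M G \<rho> c b p X = quarter_turn (metric_prod G c p) (frame c b p 1) (frame c b p 2) X"
  unfolding J_M_def gamma_def P_map_eq det_induced_metric quarter_turn_def
  using assms by (simp add: divide_inverse)

section \<open>Embedded surfaces in a Riemannian manifold\<close>

locale riemannian_surface =
  fixes M \<Sigma> :: "'p::{t2_space, second_countable_topology} set"
    and \<A> :: "('p, 'm::finite) chart set"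
    and \<B> :: "('p, 2) chart set"
    and G :: "('p, 'm) chart \<Rightarrow> 'p \<Rightarrow> real ^ 'm ^ 'm"
  assumes atlas: "smooth_atlas M \<A>"
    and metric: "riemannian_metric \<A> G"
    and surface: "embedded_surface M \<A> \<Sigma> \<B>"
begin

lemma ambient_chart: "c \<in> \<A> \<Longrightarrow> chart_of M c"
  using atlas by (simp add: smooth_atlas_def)

lemma surface_chart: "b \<in> \<B> \<Longrightarrow> chart_of \<Sigma> b"
  using surface by (simp add: embedded_surface_def smooth_atlas_def)

lemma open_overlap_surface:
  assumes "b \<in> \<B>" "b' \<in> \<B>"
  shows "open (coord b ` (dom_of b \<inter> dom_of b'))"
  using open_coord_image[OF surface_chart[OF assms(1)]] surface_chart[OF assms(2)]
  by (simp add: chart_of_def)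

lemma open_overlap_ambient:
  assumes "b \<in> \<B>" "c \<in> \<A>"
  shows "open (coord b ` (dom_of b \<inter> dom_of c))"
proof -
  have "dom_of b \<subseteq> \<Sigma>"
    using surface_chart[OF assms(1)] by (auto simp: chart_of_def dest: openin_imp_subset)
  have "\<Sigma> \<subseteq> M"
    using surface by (simp add: embedded_surface_def)
  \<comment> \<open>\<open>dom_of c\<close> is open relative to \<open>M\<close>; since \<Sigma>
    carries the subspace topology, its trace on \<Sigma> is open there.\<close>
  obtain T where "open T" "dom_of c = M \<inter> T"
    using ambient_chart[OF assms(2)] by (auto simp: chart_of_def openin_open)
  then have "\<Sigma> \<inter> dom_of c = \<Sigma> \<inter> T"
    using \<open>\<Sigma> \<subseteq> M\<close> by blast
  then have "openin (top_of_set \<Sigma>) (\<Sigma> \<inter> dom_of c)"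
    using \<open>open T\<close> by (simp add: openin_open_Int)
  then have "open (coord b ` (dom_of b \<inter> (\<Sigma> \<inter> dom_of c)))"
    using open_coord_image[OF surface_chart[OF assms(1)]] by blast
  moreover have "dom_of b \<inter> (\<Sigma> \<inter> dom_of c) = dom_of b \<inter> dom_of c"
    using \<open>dom_of b \<subseteq> \<Sigma>\<close> by blast
  ultimately show ?thesis
    by simp
qed

lemma smooth_inclusion:
  "b \<in> \<B> \<Longrightarrow> c \<in> \<A> \<Longrightarrow> smooth_on (coord b ` (dom_of b \<inter> dom_of c)) (coord c \<circ> param b)"
  using surface by (simp add: embedded_surface_def)

lemma differentiable_inclusion:
  "b \<in> \<B> \<Longrightarrow> c \<in> \<A> \<Longrightarrow> p \<in> dom_of b \<Longrightarrow> p \<in> dom_of c \<Longrightarrow>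
    (coord c \<circ> param b) differentiable (at (coord b p))"
  using smooth_on_imp_differentiable[OF smooth_inclusion] by blast

lemma differentiable_ambient:
  "c \<in> \<A> \<Longrightarrow> d \<in> \<A> \<Longrightarrow> p \<in> dom_of c \<Longrightarrow> p \<in> dom_of d \<Longrightarrow>
    (coord d \<circ> param c) differentiable (at (coord c p))"
  using atlas unfolding smooth_atlas_def
  by (intro smooth_on_imp_differentiable[of "coord c ` (dom_of c \<inter> dom_of d)"]) auto

lemma differentiable_surface:
  "b \<in> \<B> \<Longrightarrow> d \<in> \<B> \<Longrightarrow> p \<in> dom_of b \<Longrightarrow> p \<in> dom_of d \<Longrightarrow>
    (coord d \<circ> param b) differentiable (at (coord b p))"
  using surface unfolding embedded_surface_def smooth_atlas_def
  by (intro smooth_on_imp_differentiable[of "coord b ` (dom_of b \<inter> dom_of d)"]) auto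

lemma frame_eq:
  "b \<in> \<B> \<Longrightarrow> c \<in> \<A> \<Longrightarrow> p \<in> dom_of b \<Longrightarrow> p \<in> dom_of c \<Longrightarrow> frame c b p a = coord_deriv b c p (axis a 1)"
  by (rule frame_eq_coord_deriv[OF differentiable_inclusion])

lemma linear_coord_deriv_inclusion:
  "b \<in> \<B> \<Longrightarrow> c \<in> \<A> \<Longrightarrow> p \<in> dom_of b \<Longrightarrow> p \<in> dom_of c \<Longrightarrow> linear (coord_deriv b c p)"
  unfolding coord_deriv_def by (rule linear_frechet_derivative[OF differentiable_inclusion])

text \<open>The frame is the image of the standard basis under the differential of the inclusion,
  which is injective for an immersion.\<close>

lemma frame_independent:
  assumes "b \<in> \<B>" "c \<in> \<A>" "p \<in> dom_of b" "p \<in> dom_of c"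
    and "s *\<^sub>R frame c b p 1 + t *\<^sub>R frame c b p 2 = 0"
  shows "s = 0 \<and> t = 0"
proof -
  have "inj (coord_deriv b c p)"
    using surface assms unfolding embedded_surface_def by blast
  moreover have lin: "linear (coord_deriv b c p)"
    using assms by (simp add: linear_coord_deriv_inclusion)
  moreover have "coord_deriv b c p (s *\<^sub>R axis 1 1 + t *\<^sub>R axis 2 1) = 0"
    using assms by (simp add: linear_add[OF lin] linear_cmul[OF lin] frame_eq)
  ultimately have "s *\<^sub>R axis 1 1 + t *\<^sub>R axis 2 1 = (0 :: real ^ 2)"
    using linear_injective_0 by blast
  then show ?thesis
    by (simp add: vec_eq_iff forall_2 axis_def)
qed

lemma det_induced_metric_pos:
  "b \<in> \<B> \<Longrightarrow> c \<in> \<A> \<Longrightarrow> p \<in> dom_of b \<Longrightarrow> p \<in> dom_of c \<Longrightarrow> 0 < det (induced_metric G c b p)"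
  unfolding det_induced_metric
  by (rule pos_def_form.gram_det_pos[OF pos_def_form_metric_prod[OF metric] frame_independent])

text \<open>Since \<open>g\<^sub>a\<^sub>b Y\<^sup>b = B(e\<^sub>a, Y)\<close>, contracting with the
  Levi-Civita symbol leaves
  \<open>B(e\<^sub>2, Y) e\<^sub>1 - B(e\<^sub>1, Y) e\<^sub>2\<close>.\<close>

lemma J_Sigma_eq:
  assumes "b \<in> \<B>" "c \<in> \<A>" "p \<in> dom_of b" "p \<in> dom_of c" "Y \<in> tangent_space c b p"
  shows "J_Sigma G c b p Y = quarter_turn (metric_prod G c p) (frame c b p 1) (frame c b p 2) Y"
proof -
  interpret pos_def_form "metric_prod G c p"
    by (rule pos_def_form_metric_prod[OF metric assms(2,4)])
  obtain s t where Y: "Y = s *\<^sub>R frame c b p 1 + t *\<^sub>R frame c b p 2"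
    using assms(5) unfolding tangent_space_eq by (rule span_pairE)
  have uniq: "X $ 1 = s \<and> X $ 2 = t" if "Y = (\<Sum>a\<in>UNIV. X $ a *\<^sub>R frame c b p a)" for X :: "real ^ 2"
  proof -
    have "s *\<^sub>R frame c b p 1 + t *\<^sub>R frame c b p 2 = X $ 1 *\<^sub>R frame c b p 1 + X $ 2 *\<^sub>R frame c b p 2"
      using that unfolding Y sum_2 .
    then have "(X $ 1 - s) *\<^sub>R frame c b p 1 + (X $ 2 - t) *\<^sub>R frame c b p 2 = 0"
      unfolding scaleR_diff_left add_diff_add[symmetric] by simp
    then show ?thesis
      using frame_independent[OF assms(1-4), of "X $ 1 - s" "X $ 2 - t"] by simp
  qed
  \<comment> \<open>The \<open>THE\<close> in the components is meaningful only because the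
    independent frame makes them unique.\<close>
  have "tangent_components c b p Y = vector [s, t]"
    unfolding tangent_components_def
  proof (rule the_equality)
    show "Y = (\<Sum>a\<in>UNIV. vector [s, t] $ a *\<^sub>R frame c b p a)"
      by (simp add: Y sum_2)
    show "X = vector [s, t]" if "Y = (\<Sum>a\<in>UNIV. X $ a *\<^sub>R frame c b p a)" for X
      using uniq[OF that] by (simp add: vec_eq_iff forall_2)
  qed
  moreover have "metric_prod G c p X Y =
      s * metric_prod G c p X (frame c b p 1) + t * metric_prod G c p X (frame c b p 2)" for X
    unfolding Y by (simp add: simps)
  ultimately show ?thesis
    unfolding J_Sigma_def quarter_turn_def det_induced_metric
    by (simp add: sum_2 induced_metric_def algebra_simps)
qed

section \<open>Behaviour under changes of charts\<close>

lemma frame_ambient_change: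
  assumes "b \<in> \<B>" "c \<in> \<A>" "c' \<in> \<A>" "p \<in> dom_of b" "p \<in> dom_of c" "p \<in> dom_of c'"
  shows "frame c' b p a = coord_deriv c c' p (frame c b p a)"
  using assms coord_deriv_chain[OF ambient_chart surface_chart open_overlap_ambient _ _
      differentiable_inclusion differentiable_ambient, of c b p c']
  by (simp add: frame_eq)

text \<open>Column \<open>a\<close> of the Jacobian holds the coefficients of the old frame vector
  in the new frame.\<close>

lemma frame_surface_change:
  assumes "b \<in> \<B>" "b' \<in> \<B>" "c \<in> \<A>" "p \<in> dom_of b" "p \<in> dom_of b'" "p \<in> dom_of c"
  shows "frame c b p a = matrix (coord_deriv b b' p) $ 1 $ a *\<^sub>R frame c b' p 1 +
    matrix (coord_deriv b b' p) $ 2 $ a *\<^sub>R frame c b' p 2"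
proof -
  let ?w = "coord_deriv b b' p (axis a 1)"
  have w: "?w = ?w $ 1 *\<^sub>R axis 1 1 + ?w $ 2 *\<^sub>R axis 2 1"
    by (simp add: vec_eq_iff forall_2 axis_def)
  have lin: "linear (coord_deriv b' c p)"
    using assms by (simp add: linear_coord_deriv_inclusion)
  have "frame c b p a = coord_deriv b' c p ?w"
    using assms coord_deriv_chain[OF surface_chart surface_chart open_overlap_surface _ _
        differentiable_surface differentiable_inclusion, of b' b p c]
    by (simp add: frame_eq)
  also have "\<dots> = ?w $ 1 *\<^sub>R frame c b' p 1 + ?w $ 2 *\<^sub>R frame c b' p 2"
    using assms by (subst w) (simp add: linear_add[OF lin] linear_cmul[OF lin] frame_eq)
  finally show ?thesis
    by (simp add: matrix_def)
qed

text \<open>The differential of an ambient coordinate change is linear, preserves the metric and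
  carries frame to frame, so it commutes with anything built from these data.\<close>

lemma quarter_turn_ambient_change:
  assumes "b \<in> \<B>" "c \<in> \<A>" "c' \<in> \<A>" "p \<in> dom_of b" "p \<in> dom_of c" "p \<in> dom_of c'"
  shows "coord_deriv c c' p (quarter_turn (metric_prod G c p) (frame c b p 1) (frame c b p 2) Y) =
    quarter_turn (metric_prod G c' p) (frame c' b p 1) (frame c' b p 2) (coord_deriv c c' p Y)"
proof -
  have lin: "linear (coord_deriv c c' p)"
    unfolding coord_deriv_def
    using assms by (intro linear_frechet_derivative differentiable_ambient)
  have "metric_prod G c' p (coord_deriv c c' p X) (coord_deriv c c' p Z) = metric_prod G c p X Z" for X Z
    using metric assms unfolding riemannian_metric_def by blast
  then show ?thesis
    unfolding quarter_turn_def frame_ambient_change[OF assms]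
    by (simp add: linear_diff[OF lin] linear_cmul[OF lin])
qed

lemma quarter_turn_surface_change:
  assumes "b \<in> \<B>" "b' \<in> \<B>" "c \<in> \<A>" "p \<in> dom_of b" "p \<in> dom_of b'" "p \<in> dom_of c"
    and "0 < det (matrix (coord_deriv b b' p))"
  shows "quarter_turn (metric_prod G c p) (frame c b p 1) (frame c b p 2) Y =
    quarter_turn (metric_prod G c p) (frame c b' p 1) (frame c b' p 2) Y"
  using assms(7)
  \<comment> \<open>The coefficients are the Jacobian columns, so \<open>p * s - q * r\<close>
    becomes its determinant.\<close>
  by (intro pos_def_form.quarter_turn_basis_change[OF pos_def_form_metric_prod[OF metric assms(3,6)]
        frame_surface_change[OF assms(1-6)] frame_surface_change[OF assms(1-6)]])
    (simp add: det_2 mult.commute)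

section \<open>Smooth dependence on the point of the surface\<close>

lemma smooth_frame:
  assumes "b \<in> \<B>" "c \<in> \<A>"
  shows "smooth_on (coord b ` (dom_of b \<inter> dom_of c)) (\<lambda>u. frame c b (param b u) a)"
proof (rule smooth_on_cong[OF smooth_on_frechet_derivative[OF smooth_inclusion[OF assms]]
      open_overlap_ambient[OF assms]])
  show "frechet_derivative (coord c \<circ> param b) (at u) (axis a 1) = frame c b (param b u) a"
    if "u \<in> coord b ` (dom_of b \<inter> dom_of c)" for u
    using that frame_eq[OF assms] param_coord[OF surface_chart[OF assms(1)]]
    by (auto simp: coord_deriv_def)
qed

text \<open>Smoothness of the metric is given in ambient coordinates; composing with the inclusion
  moves it to surface coordinates.\<close>

lemma smooth_metric:
  assumes "b \<in> \<B>" "c \<in> \<A>"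
  shows "smooth_on (coord b ` (dom_of b \<inter> dom_of c)) (\<lambda>u. G c (param b u))"
proof (rule smooth_on_cong[OF _ open_overlap_ambient[OF assms]])
  note pc = param_coord[OF surface_chart[OF assms(1)]] param_coord[OF ambient_chart[OF assms(2)]]
  have "smooth_on (coord c ` dom_of c) (\<lambda>x. G c (param c x))"
    using metric assms(2) by (simp add: riemannian_metric_def)
  then show "smooth_on (coord b ` (dom_of b \<inter> dom_of c)) (\<lambda>u. G c (param c ((coord c \<circ> param b) u)))"
    by (rule smooth_on_compose[OF open_overlap_ambient[OF assms] _ smooth_inclusion[OF assms], rotated])
      (auto simp: pc)
  show "G c (param c ((coord c \<circ> param b) u)) = G c (param b u)"
    if "u \<in> coord b ` (dom_of b \<inter> dom_of c)" for u
    using that by (auto simp: pc)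
qed

lemma smooth_metric_prod:
  assumes "b \<in> \<B>" "c \<in> \<A>"
    and "smooth_on (coord b ` (dom_of b \<inter> dom_of c)) X" "smooth_on (coord b ` (dom_of b \<inter> dom_of c)) Y"
  shows "smooth_on (coord b ` (dom_of b \<inter> dom_of c)) (\<lambda>u. metric_prod G c (param b u) (X u) (Y u))"
  unfolding metric_prod_def
  by (intro smooth_on_sum smooth_on_mult smooth_on_vec_nth smooth_metric open_overlap_ambient assms finite)

text \<open>All ingredients are products and differences of smooth functions except the inverse
  square root, for which \<open>gram\<close> supplies positivity.\<close>

lemma smooth_quarter_turn:
  assumes "b \<in> \<B>" "c \<in> \<A>"
  shows "smooth_on (coord b ` (dom_of b \<inter> dom_of c))
    (\<lambda>u. quarter_turn (metric_prod G c (param b u)) (frame c b (param b u) 1) (frame c b (param b u) 2)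
      (frame c b (param b u) a))"
proof -
  have gram: "0 < metric_prod G c (param b u) (frame c b (param b u) 1) (frame c b (param b u) 1) *
        metric_prod G c (param b u) (frame c b (param b u) 2) (frame c b (param b u) 2) -
      metric_prod G c (param b u) (frame c b (param b u) 1) (frame c b (param b u) 2) *
        metric_prod G c (param b u) (frame c b (param b u) 2) (frame c b (param b u) 1)"
    if "u \<in> coord b ` (dom_of b \<inter> dom_of c)" for u
  proof -
    have "param b u \<in> dom_of b" "param b u \<in> dom_of c"
      using that param_coord[OF surface_chart[OF assms(1)]] by auto
    then show ?thesis
      using det_induced_metric_pos[OF assms] by (simp add: det_induced_metric)
  qed
  show ?thesis
    unfolding quarter_turn_def
    by (intro smooth_on_scaleR smooth_on_inverse_sqrt smooth_on_diff smooth_on_mult smooth_metric_prod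
        smooth_frame open_overlap_ambient assms)
      (rule gram)
qed

text \<open>Restriction to \<open>\<B>'\<close> is for the last clause: an orientation-reversing
  change of surface charts flips the sign of the map, and a surface such as the Moebius band has no
  coherently oriented atlas.\<close>

lemma complex_structure_J_M:
  assumes "nonvanishing_density \<B> \<rho>" "\<B>' \<subseteq> \<B>" "coherently_oriented \<B>'"
  shows "complex_structure_on_tangent_bundle \<A> \<B>' (J_M G \<rho>)"
proof -
  have J: "J_M G \<rho> c b p X = quarter_turn (metric_prod G c p) (frame c b p 1) (frame c b p 2) X"
    if "b \<in> \<B>'" "p \<in> dom_of b" for c b p X
  proof -
    have "\<forall>b\<in>\<B>. \<forall>p\<in>dom_of b. \<rho> b p \<noteq> 0"
      using assms(1) unfolding nonvanishing_density_def by (elim conjE)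
    then have "\<rho> b p \<noteq> 0"
      using assms(2) that by blast
    then show ?thesis
      by (rule J_M_eq)
  qed
  show ?thesis
    unfolding complex_structure_on_tangent_bundle_def
  proof (intro conjI ballI allI)
    fix c b p assume cbp: "c \<in> \<A>" "b \<in> \<B>'" "p \<in> dom_of c \<inter> dom_of b"
    then interpret pos_def_form "metric_prod G c p"
      using pos_def_form_metric_prod[OF metric] by blast
    fix Y assume Y: "Y \<in> tangent_space c b p"
    show "J_M G \<rho> c b p Y \<in> tangent_space c b p"
      using cbp by (simp add: J tangent_space_eq quarter_turn_in_span)
    show "J_M G \<rho> c b p (s *\<^sub>R Y + t *\<^sub>R Z) = s *\<^sub>R J_M G \<rho> c b p Y + t *\<^sub>R J_M G \<rho> c b p Z" for s t Z
      using cbp by (simp add: J quarter_turn_lincomb)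
    show "J_M G \<rho> c b p (J_M G \<rho> c b p Y) = - Y"
      using cbp Y assms(2) quarter_turn_square det_induced_metric_pos[of b c p]
      by (auto simp: J tangent_space_eq det_induced_metric)
  next
    fix c b a assume cb: "c \<in> \<A>" "b \<in> \<B>'"
    then have b: "b \<in> \<B>"
      using assms by blast
    show "smooth_on (coord b ` (dom_of c \<inter> dom_of b)) (\<lambda>u. J_M G \<rho> c b (param b u) (frame c b (param b u) a))"
      unfolding Int_commute[of "dom_of c"]
      by (rule smooth_on_cong[OF smooth_quarter_turn[OF b cb(1), of a] open_overlap_ambient[OF b cb(1)]])
        (use cb in \<open>auto simp: J param_coord[OF surface_chart[OF b]]\<close>)
  next
    fix c c' b b' p Y
    assume *: "c \<in> \<A>" "c' \<in> \<A>" "b \<in> \<B>'" "b' \<in> \<B>'" "p \<in> dom_of c \<inter> dom_of c' \<inter> dom_of b \<inter> dom_of b'"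
    \<comment> \<open>The change of charts is done in two moves: from \<open>c\<close> to
      \<open>c'\<close> with \<open>b\<close> fixed, then from \<open>b\<close> to \<open>b'\<close>
      in the chart \<open>c'\<close>.\<close>
    have "0 < det (matrix (coord_deriv b b' p))"
      using assms(3) * unfolding coherently_oriented_def by blast
    moreover have "b \<in> \<B>" "b' \<in> \<B>"
      using * assms(2) by blast+
    ultimately show "coord_deriv c c' p (J_M G \<rho> c b p Y) = J_M G \<rho> c' b' p (coord_deriv c c' p Y)"
      using * quarter_turn_ambient_change[of b c c' p Y]
        quarter_turn_surface_change[of b b' c' p "coord_deriv c c' p Y"]
      by (simp add: J)
  qed
qed

end

theorem theorem3p21:
  fixes M \<Sigma> :: "'p::{t2_space, second_countable_topology} set"
    and \<A> :: "('p, 'm::finite) chart set"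
    and \<B> :: "('p, 2) chart set"
    and G :: "('p, 'm) chart \<Rightarrow> 'p \<Rightarrow> real ^ 'm ^ 'm"
    and \<rho> :: "('p, 2) chart \<Rightarrow> 'p \<Rightarrow> real"
  assumes "smooth_atlas M \<A>"
    and "riemannian_metric \<A> G"
    and "embedded_surface M \<A> \<Sigma> \<B>"
    and "nonvanishing_density \<B> \<rho>"
  shows "(\<forall>c\<in>\<A>. \<forall>b\<in>\<B>. \<forall>p\<in>dom_of c \<inter> dom_of b. \<forall>Y\<in>tangent_space c b p.
            J_M G \<rho> c b p Y = J_Sigma G c b p Y) \<and>
         (\<forall>\<B>'\<subseteq>\<B>. coherently_oriented \<B>' \<longrightarrow>
            complex_structure_on_tangent_bundle \<A> \<B>' (J_M G \<rho>))"
proof -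
  interpret riemannian_surface M \<Sigma> \<A> \<B> G
    using assms(1-3) by unfold_locales
  \<comment> \<open>Both sides are the same \<open>quarter_turn\<close>; tangency of
    \<open>Y\<close> is used for \<open>J_Sigma\<close>, whose definition needs components.\<close>
  have "J_M G \<rho> c b p Y = J_Sigma G c b p Y"
    if "c \<in> \<A>" "b \<in> \<B>" "p \<in> dom_of c" "p \<in> dom_of b" "Y \<in> tangent_space c b p" for c b p Y
    using that J_Sigma_eq J_M_eq assms(4) unfolding nonvanishing_density_def by metis
  then show ?thesis
    using complex_structure_J_M[OF assms(4)] by blast
qed

end
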